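(* Let $f\colon\mathbb R^n\to\mathbb R$ and $F\colon\mathbb R^n\to\mathbb R^m$ be twice continuously differentiable, let $D_1,\ldots,D_r\subset\mathbb R^m$ be polyhedral sets, $D:=\bigcup_{i=1}^r D_i$, and $X:=\{x\in\mathbb R^n\,|\,F(x)\in D\}$. Let $\bar x\in X$ be an S-stationary point of the problem of minimizing $f(x)$ subject to $F(x)\in D$ at which MPDC-LICQ and MPDC-SOSC are valid. Then there is some $\varepsilon>0$ such that for all $x\in X$ with $\|x-\bar x\|_2\le\varepsilon$ and all $\lambda\in\mathbb R^m$: \[ \lambda\in S(x)\ \Longrightarrow\ x=\bar x,\ \lambda=\bar\lambda, \] where $\bar\lambda$ is the uniquely determined vector in $S(\bar x)$.
   Context: A set is polyhedral if it is the intersection of finitely many (closed) half spaces. $\nabla F(x)\in\mathbb R^{m\times n}$ denotes the Jacobian, $\nabla f(x)$ the gradient. For a closed set $A\subset\mathbb R^m$ and $y\in A$, the tangent (Bouligand) cone is $\mathcal T_A(y):=\{d\,|\,\exists t_k\downarrow 0,\ \exists d_k\to d:\ y+t_kd_k\in A\ \forall k\}$, and the Fréchet normal cone is $\widehat{\mathcal N}_A(y):=\{\eta\,|\,\eta\cdot d\le 0\ \forall d\in\mathcal T_A(y)\}$. For $x\in X$, $I(x):=\{i\in\{1,\ldots,r\}\,|\,F(x)\in D_i\}$. The Lagrangian is $L(x,\lambda):=f(x)+F(x)\cdot\lambda$. For $x\in X$, $S(x):=\{\lambda\in\bigcap_{i\in I(x)}\widehat{\mathcal N}_{D_i}(F(x))\,|\,\nabla_xL(x,\lambda)=0\}$,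 and $x$ is called S-stationary if $S(x)\neq\varnothing$. The linearization cone is $\mathcal L_X(\bar x):=\{d\in\mathbb R^n\,|\,\nabla F(\bar x)d\in\mathcal T_D(F(\bar x))\}$ and the critical cone is $\mathcal C_X(\bar x):=\{d\in\mathcal L_X(\bar x)\,|\,\nabla f(\bar x)\cdot d\le 0\}$. MPDC-LICQ holds at $\bar x\in X$ if the only vector $\lambda\in\sum_{i\in I(\bar x)}\operatorname{span}\widehat{\mathcal N}_{D_i}(F(\bar x))$ with $\nabla F(\bar x)^\top\lambda=0$ is $\lambda=0$ (this implies that $S(\bar x)$ has at most one element). MPDC-SOSC holds at an S-stationary point $\bar x$ if for every $d\in\mathcal C_X(\bar x)\setminus\{0\}$ there is $\lambda\in S(\bar x)$ with $d^\top\nabla^2_{xx}L(\bar x,\lambda)d>0$. *)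

theory Defs
  imports "HOL-Analysis.Analysis"
begin

section \<open>Derivatives\<close>

text \<open>On a finite-dimensional space, continuity of the second derivative as a map into the bounded
  bilinear maps is the same as continuity of all second-order partial derivatives.\<close>

definition twice_cont_diff :: "('a::euclidean_space \<Rightarrow> 'b::euclidean_space) \<Rightarrow> bool" where
  "twice_cont_diff g \<longleftrightarrow>
    (\<exists>(g' :: 'a \<Rightarrow> 'a \<Rightarrow>\<^sub>L 'b) (g'' :: 'a \<Rightarrow> 'a \<Rightarrow>\<^sub>L ('a \<Rightarrow>\<^sub>L 'b)).
      (\<forall>x. (g has_derivative blinfun_apply (g' x)) (at x)) \<and>
      (\<forall>x. (g' has_derivative blinfun_apply (g'' x)) (at x)) \<and>
      continuous_on UNIV g'')"

definition gradient :: "(real^'n \<Rightarrow> real) \<Rightarrow> real^'n \<Rightarrow> real^'n" where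
  "gradient g x = (THE v. GDERIV g x :> v)"

lemma gradient_eqI:
  assumes "GDERIV g x :> v"
  shows "gradient g x = v"
  unfolding gradient_def
proof (rule the_equality)
  fix w assume "GDERIV g x :> w"
  then have "(\<lambda>h. h \<bullet> w) = (\<lambda>h. h \<bullet> v)"
    using assms has_derivative_unique unfolding gderiv_def by blast
  then show "w = v"
    by (metis vector_eq_ldot)
qed (fact assms)

definition hessian :: "(real^'n \<Rightarrow> real) \<Rightarrow> real^'n \<Rightarrow> real^'n^'n" where
  "hessian g x = jacobian (gradient g) (at x)"

section \<open>Tangent and normal cones\<close>

text \<open>\<open>t\<^sub>k \<down> 0\<close> is read as \<open>t\<^sub>k > 0\<close> and \<open>t\<^sub>k \<rightarrow> 0\<close>; monotonicity can be added by passing to a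
  subsequence, so it does not change the cone. Both cones are only meaningful for \<open>y \<in> A\<close>.\<close>

definition tangent_cone :: "'a::euclidean_space set \<Rightarrow> 'a \<Rightarrow> 'a set" where
  "tangent_cone A y = {d. \<exists>(t :: nat \<Rightarrow> real) (e :: nat \<Rightarrow> 'a).
      (\<forall>k. t k > 0) \<and> t \<longlonglongrightarrow> 0 \<and> e \<longlonglongrightarrow> d \<and> (\<forall>k. y + t k *\<^sub>R e k \<in> A)}"

definition frechet_normal_cone :: "'a::euclidean_space set \<Rightarrow> 'a \<Rightarrow> 'a set" where
  "frechet_normal_cone A y = {\<eta>. \<forall>d\<in>tangent_cone A y. \<eta> \<bullet> d \<le> 0}"

section \<open>Mathematical programs with disjunctive constraints\<close>

text \<open>The problem is to minimize \<open>f x\<close> subject to \<open>F x \<in> D 1 \<union> \<dots> \<union> D r\<close>. Only the values of \<open>D\<close> on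
  \<open>{1..r}\<close> are used.\<close>

definition constraint_set :: "(nat \<Rightarrow> (real^'m) set) \<Rightarrow> nat \<Rightarrow> (real^'m) set" where
  "constraint_set D r = (\<Union>i\<in>{1..r}. D i)"

definition feasible_set ::
    "(real^'n \<Rightarrow> real^'m) \<Rightarrow> (nat \<Rightarrow> (real^'m) set) \<Rightarrow> nat \<Rightarrow> (real^'n) set" where
  "feasible_set F D r = {x. F x \<in> constraint_set D r}"

definition active_indices ::
    "(real^'n \<Rightarrow> real^'m) \<Rightarrow> (nat \<Rightarrow> (real^'m) set) \<Rightarrow> nat \<Rightarrow> real^'n \<Rightarrow> nat set" where
  "active_indices F D r x = {i\<in>{1..r}. F x \<in> D i}"

definition lagrangian ::
    "(real^'n \<Rightarrow> real) \<Rightarrow> (real^'n \<Rightarrow> real^'m) \<Rightarrow> real^'n \<Rightarrow> real^'m \<Rightarrow> real" where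
  "lagrangian f F x l = f x + F x \<bullet> l"

definition S_multipliers ::
    "(real^'n \<Rightarrow> real) \<Rightarrow> (real^'n \<Rightarrow> real^'m) \<Rightarrow> (nat \<Rightarrow> (real^'m) set) \<Rightarrow> nat \<Rightarrow> real^'n \<Rightarrow> (real^'m) set"
  where
  "S_multipliers f F D r x =
    {l \<in> (\<Inter>i\<in>active_indices F D r x. frechet_normal_cone (D i) (F x)).
      gradient (\<lambda>z. lagrangian f F z l) x = 0}"

definition S_stationary ::
    "(real^'n \<Rightarrow> real) \<Rightarrow> (real^'n \<Rightarrow> real^'m) \<Rightarrow> (nat \<Rightarrow> (real^'m) set) \<Rightarrow> nat \<Rightarrow> real^'n \<Rightarrow> bool"
  where
  "S_stationary f F D r x \<longleftrightarrow> x \<in> feasible_set F D r \<and> S_multipliers f F D r x \<noteq> {}"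

definition linearization_cone ::
    "(real^'n \<Rightarrow> real^'m) \<Rightarrow> (nat \<Rightarrow> (real^'m) set) \<Rightarrow> nat \<Rightarrow> real^'n \<Rightarrow> (real^'n) set" where
  "linearization_cone F D r x =
    {d. jacobian F (at x) *v d \<in> tangent_cone (constraint_set D r) (F x)}"

definition critical_cone ::
    "(real^'n \<Rightarrow> real) \<Rightarrow> (real^'n \<Rightarrow> real^'m) \<Rightarrow> (nat \<Rightarrow> (real^'m) set) \<Rightarrow> nat \<Rightarrow> real^'n \<Rightarrow> (real^'n) set"
  where
  "critical_cone f F D r x = {d \<in> linearization_cone F D r x. gradient f x \<bullet> d \<le> 0}"

text \<open>The sum over the active indices is the Minkowski sum of subspaces (HOL-Library's
  \<open>Set_Algebras\<close>); see \<open>set_sum_alt\<close> for its elementwise description.\<close>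

definition MPDC_LICQ ::
    "(real^'n \<Rightarrow> real^'m) \<Rightarrow> (nat \<Rightarrow> (real^'m) set) \<Rightarrow> nat \<Rightarrow> real^'n \<Rightarrow> bool" where
  "MPDC_LICQ F D r x \<longleftrightarrow>
    (\<forall>l \<in> (\<Sum>i\<in>active_indices F D r x. span (frechet_normal_cone (D i) (F x))).
      transpose (jacobian F (at x)) *v l = 0 \<longrightarrow> l = 0)"

definition MPDC_SOSC ::
    "(real^'n \<Rightarrow> real) \<Rightarrow> (real^'n \<Rightarrow> real^'m) \<Rightarrow> (nat \<Rightarrow> (real^'m) set) \<Rightarrow> nat \<Rightarrow> real^'n \<Rightarrow> bool"
  where
  "MPDC_SOSC f F D r x \<longleftrightarrow>
    (\<forall>d \<in> critical_cone f F D r x - {0}. \<exists>l \<in> S_multipliers f F D r x.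
      d \<bullet> (hessian (\<lambda>z. lagrangian f F z l) x *v d) > 0)"

end

theory Submission
  imports Defs
begin

text \<open>Suppose feasible points \<open>x\<^sub>k \<noteq> xbar\<close> with multipliers \<open>\<lambda>\<^sub>k \<in> S x\<^sub>k\<close> converge to \<open>xbar\<close>; we
  may assume that all \<open>F x\<^sub>k\<close> lie in one piece \<open>D\<^sub>i\<close>. Near \<open>F xbar\<close> the normal cones of a polyhedron
  are contained in the normal cone at \<open>F xbar\<close>, so \<open>\<lambda>\<^sub>k\<close> lies in the latter and is orthogonal to
  \<open>F x\<^sub>k - F xbar\<close>, and LICQ gives \<open>\<lambda>\<^sub>k \<rightarrow> lbar\<close>. A limit \<open>d\<close> of the normalized directions
  \<open>x\<^sub>k - xbar\<close> is therefore critical. Subtracting the stationarity conditions at \<open>x\<^sub>k\<close> and \<open>xbar\<close>,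
  testing with \<open>x\<^sub>k - xbar\<close> and dividing by \<open>\<parallel>x\<^sub>k - xbar\<parallel>\<^sup>2\<close> shows that the Hessian of the Lagrangian is
  nonpositive along \<open>d\<close>, because
  \<open>(\<lambda>\<^sub>k - lbar) \<bullet> (F x\<^sub>k - F xbar) = - lbar \<bullet> (F x\<^sub>k - F xbar) \<ge> 0\<close>. This contradicts SOSC.\<close>

section \<open>Tangent and normal cones of polyhedra\<close>

lemma tangent_coneI:
  assumes "\<And>k. t k > 0" "t \<longlonglongrightarrow> 0" "e \<longlonglongrightarrow> d" "\<And>k::nat. y + t k *\<^sub>R e k \<in> A"
  shows "d \<in> tangent_cone A y"
  using assms unfolding tangent_cone_def by blast

lemma tangent_cone_mono: "A \<subseteq> B \<Longrightarrow> tangent_cone A y \<subseteq> tangent_cone B y"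
  unfolding tangent_cone_def by blast

lemma tangent_cone_feasible_direction:
  assumes "\<delta> > 0" "\<And>s. 0 < s \<Longrightarrow> s \<le> \<delta> \<Longrightarrow> y + s *\<^sub>R d \<in> A"
  shows "d \<in> tangent_cone A y"
proof (rule tangent_coneI)
  show "(\<lambda>k. \<delta> / real (Suc k)) \<longlonglongrightarrow> 0"
    by (rule LIMSEQ_Suc, rule lim_const_over_n)
  show "y + (\<delta> / real (Suc k)) *\<^sub>R d \<in> A" for k
    using assms by (intro assms(2)) (auto simp: field_simps)
qed (use assms in auto)

lemma tangent_cone_convex:
  assumes "convex A" "y \<in> A" "z \<in> A"
  shows "z - y \<in> tangent_cone A y"
proof (rule tangent_cone_feasible_direction[of 1])
  fix s :: real assume "0 < s" "s \<le> 1"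
  then have "(1 - s) *\<^sub>R y + s *\<^sub>R z \<in> A"
    using assms by (intro convexD) auto
  then show "y + s *\<^sub>R (z - y) \<in> A"
    by (simp add: algebra_simps)
qed simp

lemma tangent_cone_halfspace:
  assumes "a \<bullet> y = b" "A \<subseteq> {x. a \<bullet> x \<le> b}" "d \<in> tangent_cone A y"
  shows "a \<bullet> d \<le> 0"
proof -
  obtain t :: "nat \<Rightarrow> real" and e where te: "\<And>k. t k > 0" "e \<longlonglongrightarrow> d" "\<And>k. y + t k *\<^sub>R e k \<in> A"
    using assms(3) unfolding tangent_cone_def by blast
  have "a \<bullet> e k \<le> 0" for k
  proof -
    have "a \<bullet> y + t k * (a \<bullet> e k) \<le> b"
      using te(3)[of k] assms(2) by (auto simp: inner_add_right)
    with assms(1) te(1)[of k] show ?thesis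
      by (simp add: mult_le_0_iff)
  qed
  moreover have "(\<lambda>k. a \<bullet> e k) \<longlonglongrightarrow> a \<bullet> d"
    by (intro tendsto_intros te)
  ultimately show ?thesis
    by (intro LIMSEQ_le_const2) auto
qed

text \<open>Inequalities that are strict at \<open>ybar\<close> stay strict nearby. Hence the
  constraints active at a nearby \<open>y\<close> are among those active at \<open>ybar\<close>, and
  fewer active constraints give a larger tangent cone.\<close>

lemma polyhedron_tangent_cone_mono:
  assumes "polyhedron A"
  shows "\<forall>\<^sub>F y in nhds ybar. y \<in> A \<longrightarrow> tangent_cone A ybar \<subseteq> tangent_cone A y"
proof -
  obtain H a b where H: "finite H" "A = \<Inter>H" "\<And>h. h \<in> H \<Longrightarrow> h = {x. a h \<bullet> x \<le> b h}"
    using assms unfolding polyhedron_def by metis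
  have "\<forall>\<^sub>F y in nhds ybar. \<forall>h\<in>H. a h \<bullet> ybar < b h \<longrightarrow> a h \<bullet> y < b h"
  proof (intro eventually_ball_finite[OF H(1)] ballI)
    fix h
    have "((\<lambda>y. a h \<bullet> y) \<longlongrightarrow> a h \<bullet> ybar) (nhds ybar)"
      by (intro tendsto_intros filterlim_ident)
    from order_tendstoD(2)[OF this]
    show "\<forall>\<^sub>F y in nhds ybar. a h \<bullet> ybar < b h \<longrightarrow> a h \<bullet> y < b h"
      by (cases "a h \<bullet> ybar < b h") auto
  qed
  then show ?thesis
  proof eventually_elim
    fix y assume slack: "\<forall>h\<in>H. a h \<bullet> ybar < b h \<longrightarrow> a h \<bullet> y < b h"
    show "y \<in> A \<longrightarrow> tangent_cone A ybar \<subseteq> tangent_cone A y"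
    proof (intro impI subsetI)
      fix d assume y: "y \<in> A" and d: "d \<in> tangent_cone A ybar"
      have "\<forall>\<^sub>F s in at_right (0::real). \<forall>h\<in>H. a h \<bullet> (y + s *\<^sub>R d) \<le> b h"
      proof (intro eventually_ball_finite[OF H(1)] ballI)
        fix h assume h: "h \<in> H"
        have yh: "a h \<bullet> y \<le> b h" and sub: "A \<subseteq> {x. a h \<bullet> x \<le> b h}"
          using y h H(2) H(3)[OF h] by auto
        \<comment> \<open>Closedness puts \<open>ybar\<close> in \<open>A\<close>, as the limit of
          the points of \<open>A\<close> that witness the tangent direction.\<close>
        have "ybar \<in> A"
        proof -
          obtain t :: "nat \<Rightarrow> real" and e where te: "t \<longlonglongrightarrow> 0" "e \<longlonglongrightarrow> d" "\<And>k. ybar + t k *\<^sub>R e k \<in> A"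
            using d unfolding tangent_cone_def by blast
          have "(\<lambda>k. ybar + t k *\<^sub>R e k) \<longlonglongrightarrow> ybar + 0 *\<^sub>R d"
            by (intro tendsto_intros te)
          from closed_sequentially[OF polyhedron_imp_closed[OF assms] te(3) this] show ?thesis
            by simp
        qed
        \<comment> \<open>With slack at \<open>y\<close>, continuity keeps the inequality for small
          \<open>s\<close>; if the constraint is active at \<open>ybar\<close>, the tangent
          direction \<open>d\<close> does not increase its left-hand side.\<close>
        then consider "a h \<bullet> y < b h" | "a h \<bullet> ybar = b h"
          using slack h sub by fastforce
        then show "\<forall>\<^sub>F s in at_right (0::real). a h \<bullet> (y + s *\<^sub>R d) \<le> b h"
        proof cases
          case 1
          have "((\<lambda>s. a h \<bullet> (y + s *\<^sub>R d)) \<longlongrightarrow> a h \<bullet> (y + 0 *\<^sub>R d)) (at_right (0::real))"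
            by (intro tendsto_intros)
          from order_tendstoD(2)[OF this, of "b h"] 1 show ?thesis
            by (auto elim: eventually_mono)
        next
          case 2
          then have "a h \<bullet> d \<le> 0"
            using tangent_cone_halfspace sub d by blast
          then have "a h \<bullet> (y + s *\<^sub>R d) \<le> b h" if "s > 0" for s
            using yh that by (simp add: inner_add_right add_nonpos_nonpos mult_le_0_iff
                add_decreasing2)
          then show ?thesis
            using eventually_at_right_less[of "0::real"] by (rule eventually_mono[rotated])
        qed
      qed
      then obtain \<delta> :: real where \<delta>: "\<delta> > 0"
        "\<And>s. 0 < s \<Longrightarrow> s < \<delta> \<Longrightarrow> \<forall>h\<in>H. a h \<bullet> (y + s *\<^sub>R d) \<le> b h"
        unfolding eventually_at_right_field by auto
      show "d \<in> tangent_cone A y"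
      proof (rule tangent_cone_feasible_direction[of "\<delta> / 2"])
        show "y + s *\<^sub>R d \<in> A" if "0 < s" "s \<le> \<delta> / 2" for s
          using \<delta>(2)[of s] \<delta>(1) that H(2,3) by auto
      qed (use \<delta> in simp)
    qed
  qed
qed

text \<open>Polarity reverses the inclusion of tangent cones. By convexity \<open>y - ybar\<close>
  is tangent at \<open>ybar\<close> and \<open>ybar - y\<close> is tangent at \<open>y\<close>; a
  vector normal at both points has nonpositive product with both, hence is orthogonal.\<close>

lemma polyhedron_frechet_normal_cone:
  assumes "polyhedron A" "ybar \<in> A"
  shows "\<forall>\<^sub>F y in nhds ybar. y \<in> A \<longrightarrow> (\<forall>\<eta>\<in>frechet_normal_cone A y.
           \<eta> \<in> frechet_normal_cone A ybar \<and> \<eta> \<bullet> (y - ybar) = 0)"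
  using polyhedron_tangent_cone_mono[OF assms(1)]
proof eventually_elim
  case (elim y)
  show ?case
  proof (intro impI ballI)
    fix \<eta> assume y: "y \<in> A" and \<eta>: "\<eta> \<in> frechet_normal_cone A y"
    then have \<eta>': "\<eta> \<in> frechet_normal_cone A ybar"
      using elim unfolding frechet_normal_cone_def by blast
    have "\<eta> \<bullet> (y - ybar) \<le> 0" "\<eta> \<bullet> (ybar - y) \<le> 0"
      using tangent_cone_convex[OF polyhedron_imp_convex[OF assms(1)]] assms(2) y \<eta> \<eta>'
      unfolding frechet_normal_cone_def by blast+
    with \<eta>' show "\<eta> \<in> frechet_normal_cone A ybar \<and> \<eta> \<bullet> (y - ybar) = 0"
      by (simp add: inner_diff_right)
  qed
qed

section \<open>Difference quotients and remainders\<close>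

text \<open>The remainder quotient vanishes along \<open>X\<close>, and the linear part of the
  increment is \<open>g'\<close> applied to the normalized directions, which converge to
  \<open>d\<close>.\<close>

lemma has_derivative_directional_quotient:
  assumes "(g has_derivative g') (at x)"
    and "X \<longlonglongrightarrow> x" "\<And>k. X k \<noteq> x" "(\<lambda>k. (X k - x) /\<^sub>R norm (X k - x)) \<longlonglongrightarrow> d"
  shows "(\<lambda>k::nat. (g (X k) - g x) /\<^sub>R norm (X k - x)) \<longlonglongrightarrow> g' d"
proof -
  have bl: "bounded_linear g'"
    and lim: "((\<lambda>y. ((g y - g x) - g' (y - x)) /\<^sub>R norm (y - x)) \<longlongrightarrow> 0) (at x)"
    using assms(1) unfolding has_derivative_at_within by auto
  interpret bounded_linear g' by fact
  have "filterlim X (at x) sequentially"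
    using assms(2,3) by (simp add: filterlim_at)
  from filterlim_compose[OF lim this]
  have "(\<lambda>k. ((g (X k) - g x) - g' (X k - x)) /\<^sub>R norm (X k - x)
           + g' ((X k - x) /\<^sub>R norm (X k - x))) \<longlonglongrightarrow> 0 + g' d"
    by (intro tendsto_add tendsto assms(4))
  then show ?thesis
    by (simp add: scaleR flip: scaleR_add_right)
qed

text \<open>The linear term is taken at the moving point \<open>x\<close>, not at \<open>x0\<close>,
  because stationarity at \<open>x\<close> involves the derivative there.\<close>

lemma second_order_remainder:
  fixes g :: "'a::real_normed_vector \<Rightarrow> 'b::real_normed_vector"
    and g' :: "'a \<Rightarrow> 'a \<Rightarrow>\<^sub>L 'b"
  assumes "\<And>x. (g has_derivative blinfun_apply (g' x)) (at x)"
    and "(g' has_derivative g'') (at x0)"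
  shows "\<exists>K\<ge>0. \<forall>\<^sub>F x in nhds x0. norm (g x - g x0 - g' x (x - x0)) \<le> K * (norm (x - x0))\<^sup>2"
proof -
  have bl: "bounded_linear g''"
    and "\<forall>e>0. \<exists>\<rho>>0. \<forall>y. norm (y - x0) < \<rho> \<longrightarrow>
      norm (g' y - g' x0 - g'' (y - x0)) \<le> e * norm (y - x0)"
    using assms(2) unfolding has_derivative_at_alt by auto
  then obtain \<rho> where \<rho>: "\<rho> > 0"
    "\<And>y. norm (y - x0) < \<rho> \<Longrightarrow> norm (g' y - g' x0 - g'' (y - x0)) \<le> norm (y - x0)"
    by (metis mult_1 zero_less_one)
  obtain C where C: "\<And>h. norm (g'' h) \<le> norm h * C" "C \<ge> 0"
    using bounded_linear.nonneg_bounded[OF bl] by auto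
  \<comment> \<open>\<open>C\<close> bounds the linear map \<open>g''\<close>, and the summand 1 is
    the tolerance with which it approximates \<open>g'\<close> near \<open>x0\<close>.\<close>
  define L where "L = C + 1"
  have L: "norm (g' y - g' x0) \<le> L * norm (y - x0)" if "norm (y - x0) < \<rho>" for y
    using norm_triangle_sub[of "g' y - g' x0" "g'' (y - x0)"] \<rho>(2)[OF that] C(1)[of "y - x0"]
    by (simp add: L_def algebra_simps)
  have "norm (g x - g x0 - g' x (x - x0)) \<le> 2 * L * (norm (x - x0))\<^sup>2" if x: "norm (x - x0) < \<rho>" for x
  proof -
    \<comment> \<open>Mean value inequality for \<open>g\<close> minus the fixed linear map
      \<open>g' x\<close>: the derivative \<open>g' z - g' x\<close> is compared through
      \<open>g' x0\<close>, which costs the factor 2.\<close>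
    have "norm ((g x - g' x x) - (g x0 - g' x x0)) \<le> (2 * L * norm (x - x0)) * norm (x - x0)"
    proof (rule differentiable_bound[where S = "cball x0 (norm (x - x0))"
          and f = "\<lambda>z. g z - g' x z" and f' = "\<lambda>z. blinfun_apply (g' z - g' x)"])
      fix z assume z: "z \<in> cball x0 (norm (x - x0))"
      show "((\<lambda>z. g z - g' x z) has_derivative (g' z - g' x)) (at z within cball x0 (norm (x - x0)))"
        by (auto intro!: derivative_eq_intros has_derivative_at_withinI[OF assms(1)]
            simp: blinfun.diff_left)
      have "norm (z - x0) \<le> norm (x - x0)"
        using z by (simp add: dist_norm norm_minus_commute)
      then have "norm (g' z - g' x0) \<le> L * norm (x - x0)"
        using L[of z] x C(2) by (smt (verit) L_def mult_left_mono)
      moreover have "norm (g' x - g' x0) \<le> L * norm (x - x0)"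
        using L x by blast
      ultimately have "norm (g' z - g' x) \<le> 2 * L * norm (x - x0)"
        using norm_triangle_ineq4[of "g' z - g' x0" "g' x - g' x0"] by simp
      then show "onorm (g' z - g' x) \<le> 2 * L * norm (x - x0)"
        by (simp add: norm_blinfun.rep_eq)
    qed (auto simp: dist_norm norm_minus_commute)
    then show ?thesis
      by (simp add: blinfun.diff_right algebra_simps power2_eq_square)
  qed
  then have "\<forall>\<^sub>F x in nhds x0. norm (g x - g x0 - g' x (x - x0)) \<le> 2 * L * (norm (x - x0))\<^sup>2"
    unfolding eventually_nhds_metric dist_norm using \<rho>(1) by blast
  then show ?thesis
    using C(2) by (intro exI[of _ "2 * L"]) (simp add: L_def)
qed

section \<open>Isolated stationary points for a single polyhedral constraint\<close>

text \<open>The adjoint of \<open>Fbar\<close> is injective on \<open>V\<close>, hence bounded below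
  there by some \<open>e > 0\<close>. Subtracting the two stationarity equations bounds the image of
  \<open>l k - lbar\<close> by the perturbations of the derivatives. Boundedness of \<open>l\<close>
  comes out of the same estimate.\<close>

lemma multiplier_tendsto:
  fixes f' :: "nat \<Rightarrow> 'a::euclidean_space \<Rightarrow>\<^sub>L real" and F' :: "nat \<Rightarrow> 'a \<Rightarrow>\<^sub>L 'b::euclidean_space"
    and fbar :: "'a \<Rightarrow>\<^sub>L real" and Fbar :: "'a \<Rightarrow>\<^sub>L 'b"
  assumes V: "subspace V" "\<And>l. l \<in> V \<Longrightarrow> (\<And>h. l \<bullet> Fbar h = 0) \<Longrightarrow> l = 0"
    and lim: "f' \<longlonglongrightarrow> fbar" "F' \<longlonglongrightarrow> Fbar"
    and lbar: "lbar \<in> V" "\<And>h. fbar h + lbar \<bullet> Fbar h = 0"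
    and l: "\<And>k. l k \<in> V" "\<And>k h. f' k h + l k \<bullet> F' k h = 0"
  shows "l \<longlonglongrightarrow> lbar"
proof -
  define A where "A = adjoint (blinfun_apply Fbar)"
  have A: "l \<bullet> Fbar h = A l \<bullet> h" for l h
    by (simp add: A_def inner_commute adjoint_works bounded_linear.linear blinfun.bounded_linear_right)
  have linA: "linear A"
    unfolding A_def by (intro adjoint_linear bounded_linear.linear blinfun.bounded_linear_right)
  have "\<exists>e>0. \<forall>l\<in>V. norm (A l) \<ge> e * norm l"
    using V A linA closed_subspace[OF V(1)]
    by (intro injective_imp_isometric) (auto intro: linear_conv_bounded_linear[THEN iffD1])
  then obtain e where e: "e > 0" "\<And>l. l \<in> V \<Longrightarrow> e * norm l \<le> norm (A l)"
    by blast
  define \<alpha> where "\<alpha> k = norm (F' k - Fbar)" for k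
  define \<beta> where "\<beta> k = norm (f' k - fbar)" for k
  have \<alpha>: "\<alpha> \<longlonglongrightarrow> 0" and \<beta>: "\<beta> \<longlonglongrightarrow> 0"
    unfolding \<alpha>_def \<beta>_def using lim by (simp_all add: LIM_zero tendsto_norm_zero)
  have est: "e * norm (l k - lbar) \<le> \<alpha> k * (norm (l k - lbar) + norm lbar) + \<beta> k" for k
  proof -
    \<comment> \<open>Testing the equations with this vector produces its squared norm.\<close>
    define w where "w = A (l k - lbar)"
    have "norm w * norm w = (l k - lbar) \<bullet> Fbar w"
      by (simp add: A w_def flip: power2_norm_eq_inner power2_eq_square)
    also have "\<dots> = - (l k \<bullet> (F' k - Fbar) w) - (f' k - fbar) w"
      using lbar(2)[of w] l(2)[of k w] by (simp add: blinfun.diff_left inner_diff_left inner_diff_right)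
    also have "\<dots> \<le> norm (l k) * (\<alpha> k * norm w) + \<beta> k * norm w"
    proof -
      have "\<bar>l k \<bullet> (F' k - Fbar) w\<bar> \<le> norm (l k) * norm ((F' k - Fbar) w)"
        by (rule Cauchy_Schwarz_ineq2)
      also have "\<dots> \<le> norm (l k) * (\<alpha> k * norm w)"
        unfolding \<alpha>_def by (intro mult_left_mono norm_blinfun) auto
      finally show ?thesis
        using norm_blinfun[of "f' k - fbar" w] unfolding \<beta>_def by (simp add: abs_le_iff)
    qed
    finally have "norm w * norm w \<le> (\<alpha> k * norm (l k) + \<beta> k) * norm w"
      by (simp add: algebra_simps)
    then have "norm w \<le> \<alpha> k * norm (l k) + \<beta> k"
      by (cases "norm w = 0") (auto simp: \<alpha>_def \<beta>_def)
    also have "\<dots> \<le> \<alpha> k * (norm (l k - lbar) + norm lbar) + \<beta> k"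
      using norm_triangle_sub[of "l k" lbar] by (intro add_right_mono mult_left_mono) (auto simp: \<alpha>_def)
    finally show ?thesis
      using e(2)[OF subspace_diff[OF V(1) l(1) lbar(1)], of k] by (simp add: w_def)
  qed
  \<comment> \<open>Once \<alpha> is below \<open>e / 2\<close>, the term containing
    \<open>norm (l k - lbar)\<close> on the right is absorbed by the left side.\<close>
  have "\<forall>\<^sub>F k in sequentially. norm (l k - lbar) \<le> 2 / e * (\<alpha> k * norm lbar + \<beta> k)"
    using order_tendstoD(2)[OF \<alpha> half_gt_zero[OF e(1)]]
  proof eventually_elim
    case (elim k)
    then have "\<alpha> k * norm (l k - lbar) \<le> e / 2 * norm (l k - lbar)"
      by (intro mult_right_mono) auto
    with est[of k] have "e / 2 * norm (l k - lbar) \<le> \<alpha> k * norm lbar + \<beta> k"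
      by (simp add: algebra_simps)
    with e(1) show ?case
      by (simp add: field_simps)
  qed
  moreover have "(\<lambda>k. 2 / e * (\<alpha> k * norm lbar + \<beta> k)) \<longlonglongrightarrow> 2 / e * (0 * norm lbar + 0)"
    by (intro tendsto_intros \<alpha> \<beta>)
  then have "(\<lambda>k. 2 / e * (\<alpha> k * norm lbar + \<beta> k)) \<longlonglongrightarrow> 0"
    by simp
  ultimately have "(\<lambda>k. l k - lbar) \<longlonglongrightarrow> 0"
    by (rule Lim_null_comparison)
  then show ?thesis
    by (simp add: LIM_zero_iff)
qed

text \<open>This is the local argument for one active piece \<open>A\<close>: \<open>inj\<close> is
  what LICQ provides for that piece, and \<open>sosc\<close> is the second-order condition with the
  unique multiplier inserted.\<close>

lemma isolated_stationary_point_polyhedron: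
  fixes f :: "'a::euclidean_space \<Rightarrow> real" and F :: "'a \<Rightarrow> 'b::euclidean_space"
    and f' :: "'a \<Rightarrow> 'a \<Rightarrow>\<^sub>L real" and F' :: "'a \<Rightarrow> 'a \<Rightarrow>\<^sub>L 'b"
    and f'' :: "'a \<Rightarrow> 'a \<Rightarrow>\<^sub>L real" and F'' :: "'a \<Rightarrow> 'a \<Rightarrow>\<^sub>L 'b"
  assumes F: "\<And>x. (F has_derivative blinfun_apply (F' x)) (at x)"
    and f': "(f' has_derivative f'') (at xbar)" and F': "(F' has_derivative F'') (at xbar)"
    and A: "polyhedron A" "F xbar \<in> A"
    and lbar: "lbar \<in> frechet_normal_cone A (F xbar)" "\<And>h. f' xbar h + lbar \<bullet> F' xbar h = 0"
    and inj: "\<And>l. l \<in> span (frechet_normal_cone A (F xbar)) \<Longrightarrow> (\<And>h. l \<bullet> F' xbar h = 0) \<Longrightarrow> l = 0"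
    and sosc: "\<And>d. d \<noteq> 0 \<Longrightarrow> F' xbar d \<in> tangent_cone A (F xbar) \<Longrightarrow> f' xbar d \<le> 0 \<Longrightarrow>
      f'' d d + lbar \<bullet> F'' d d > 0"
  shows "\<forall>\<^sub>F x in at xbar. F x \<in> A \<longrightarrow>
    \<not> (\<exists>l\<in>frechet_normal_cone A (F x). \<forall>h. f' x h + l \<bullet> F' x h = 0)"
proof (rule ccontr)
  let ?N = "frechet_normal_cone A (F xbar)"
  define bad where "bad x \<longleftrightarrow> F x \<in> A \<and>
    (\<exists>l\<in>frechet_normal_cone A (F x). \<forall>h. f' x h + l \<bullet> F' x h = 0)" for x
  assume "\<not> ?thesis"
  then have freq: "\<exists>\<^sub>F x in at xbar. bad x"
    by (simp add: frequently_def bad_def)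
  obtain K where K: "K \<ge> 0"
    "\<forall>\<^sub>F x in nhds xbar. norm (F x - F xbar - F' x (x - xbar)) \<le> K * (norm (x - xbar))\<^sup>2"
    using second_order_remainder[OF F F'] by blast
  have "(F \<longlongrightarrow> F xbar) (nhds xbar)"
    using has_derivative_continuous[OF F] by (simp add: isCont_def tendsto_at_iff_tendsto_nhds)
  with polyhedron_frechet_normal_cone[OF A]
  have "\<forall>\<^sub>F x in nhds xbar. F x \<in> A \<longrightarrow> (\<forall>\<eta>\<in>frechet_normal_cone A (F x).
      \<eta> \<in> ?N \<and> \<eta> \<bullet> (F x - F xbar) = 0)"
    by (rule eventually_compose_filterlim)
  then have ev: "\<forall>\<^sub>F x in at xbar. norm (F x - F xbar - F' x (x - xbar)) \<le> K * (norm (x - xbar))\<^sup>2 \<and>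
      (F x \<in> A \<longrightarrow> (\<forall>\<eta>\<in>frechet_normal_cone A (F x). \<eta> \<in> ?N \<and> \<eta> \<bullet> (F x - F xbar) = 0))"
    using K(2) by (auto simp: eventually_at_filter elim: eventually_elim2)
  \<comment> \<open>The bad points occur frequently and the estimates hold eventually, so each
    radius admits a point with both; no tail of the sequence has to be discarded later.\<close>
  have "\<exists>x. x \<noteq> xbar \<and> norm (x - xbar) < 1 / real (Suc n) \<and> F x \<in> A \<and>
      norm (F x - F xbar - F' x (x - xbar)) \<le> K * (norm (x - xbar))\<^sup>2 \<and>
      (\<exists>l\<in>?N. l \<bullet> (F x - F xbar) = 0 \<and> (\<forall>h. f' x h + l \<bullet> F' x h = 0))" for n
  proof -
    have "\<forall>\<^sub>F x in at xbar. x \<noteq> xbar \<and> norm (x - xbar) < 1 / real (Suc n)"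
      unfolding eventually_at by (intro exI[of _ "1 / real (Suc n)"]) (auto simp: dist_norm)
    from frequently_ex[OF frequently_eventually_frequently[OF freq eventually_conj[OF ev this]]]
    show ?thesis
      unfolding bad_def by blast
  qed
  then obtain Y m where Y: "\<And>n. Y n \<noteq> xbar" "\<And>n. norm (Y n - xbar) < 1 / real (Suc n)"
    "\<And>n. F (Y n) \<in> A"
    "\<And>n. norm (F (Y n) - F xbar - F' (Y n) (Y n - xbar)) \<le> K * (norm (Y n - xbar))\<^sup>2"
    and m: "\<And>n. m n \<in> ?N" "\<And>n. m n \<bullet> (F (Y n) - F xbar) = 0"
    "\<And>n h. f' (Y n) h + m n \<bullet> F' (Y n) h = 0"
    by metis
  have "(\<lambda>n. Y n - xbar) \<longlonglongrightarrow> 0"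
    using Y(2) by (intro Lim_null_comparison[OF _ LIMSEQ_inverse_real_of_nat])
      (auto intro!: always_eventually less_imp_le simp: inverse_eq_divide)
  then have limY: "Y \<longlonglongrightarrow> xbar"
    by (simp add: LIM_zero_iff)
  \<comment> \<open>Compactness of the unit sphere yields a limit direction of norm 1, in particular
    a nonzero one.\<close>
  have "\<forall>n. (Y n - xbar) /\<^sub>R norm (Y n - xbar) \<in> sphere 0 1"
    using Y(1) by simp
  from seq_compactE[OF compact_imp_seq_compact[OF compact_sphere] this] obtain d and \<phi> :: "nat \<Rightarrow> nat" where d: "d \<in> sphere 0 1"
    and \<phi>: "strict_mono \<phi>"
    and limd: "((\<lambda>n. (Y n - xbar) /\<^sub>R norm (Y n - xbar)) \<circ> \<phi>) \<longlonglongrightarrow> d"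
    by blast
  define X l where "X = Y \<circ> \<phi>" and "l = m \<circ> \<phi>"
  define t u where "t k = norm (X k - xbar)" and "u k = (X k - xbar) /\<^sub>R t k" for k
  have X: "X k \<noteq> xbar" "F (X k) \<in> A"
    "norm (F (X k) - F xbar - F' (X k) (X k - xbar)) \<le> K * (t k)\<^sup>2" for k
    using Y by (simp_all add: X_def t_def)
  have l: "l k \<in> ?N" "l k \<bullet> (F (X k) - F xbar) = 0" "f' (X k) h + l k \<bullet> F' (X k) h = 0" for k h
    using m by (simp_all add: X_def l_def)
  have t: "t k > 0" for k
    using X(1) by (simp add: t_def)
  have limX: "X \<longlonglongrightarrow> xbar"
    unfolding X_def using limY \<phi> by (rule LIMSEQ_subseq_LIMSEQ)
  have limu: "u \<longlonglongrightarrow> d"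
    using limd by (simp add: u_def[abs_def] t_def X_def comp_def)
  note quot = has_derivative_directional_quotient[OF _ limX X(1) limu[unfolded u_def t_def], folded t_def]
  have limt: "t \<longlonglongrightarrow> 0"
    unfolding t_def using limX by (simp add: LIM_zero tendsto_norm_zero)
  have "l \<longlonglongrightarrow> lbar"
  proof (rule multiplier_tendsto)
    show "subspace (span ?N)"
      by simp
    show "(\<lambda>k. f' (X k)) \<longlonglongrightarrow> f' xbar" "(\<lambda>k. F' (X k)) \<longlonglongrightarrow> F' xbar"
      using has_derivative_continuous[OF f'] has_derivative_continuous[OF F'] limX
      by (auto intro: isCont_tendsto_compose)
  qed (use inj lbar l span_base in blast)+
  have limF: "(\<lambda>k. (F (X k) - F xbar) /\<^sub>R t k) \<longlonglongrightarrow> F' xbar d"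
    by (rule quot[OF F])
  \<comment> \<open>The difference quotients of \<open>F\<close> serve as the directions in the
    tangent cone, since \<open>F xbar\<close> plus \<open>t k\<close> times the quotient is
    \<open>F (X k)\<close>.\<close>
  have tan: "F' xbar d \<in> tangent_cone A (F xbar)"
    by (rule tangent_coneI[OF t limt limF]) (use t X(2) in \<open>simp add: less_imp_neq[symmetric]\<close>)
  \<comment> \<open>Orthogonality of \<open>l k\<close> to the increment passes to the limit;
    stationarity at \<open>xbar\<close> then makes \<open>d\<close> critical.\<close>
  have "(\<lambda>k. l k \<bullet> ((F (X k) - F xbar) /\<^sub>R t k)) \<longlonglongrightarrow> lbar \<bullet> F' xbar d"
    by (intro tendsto_intros \<open>l \<longlonglongrightarrow> lbar\<close> limF)
  then have "lbar \<bullet> F' xbar d = 0"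
    by (simp add: l(2) LIMSEQ_const_iff)
  then have "f' xbar d \<le> 0"
    using lbar(2)[of d] by simp
  with d tan have pos: "f'' d d + lbar \<bullet> F'' d d > 0"
    by (intro sosc) auto
  \<comment> \<open>\<open>Q k\<close> is the difference quotient of the Lagrangian's derivative
    with multiplier frozen at \<open>lbar\<close>, evaluated at \<open>u k\<close>; its limit is the
    Hessian form along \<open>d\<close>.\<close>
  define Q where "Q k = ((f' (X k) - f' xbar) /\<^sub>R t k) (u k) + lbar \<bullet> ((F' (X k) - F' xbar) /\<^sub>R t k) (u k)" for k
  have limQ: "Q \<longlonglongrightarrow> f'' d d + lbar \<bullet> F'' d d"
    unfolding Q_def by (intro tendsto_intros quot[OF f'] quot[OF F'] limu)
  have "Q k \<le> norm (l k - lbar) * K" for k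
  proof -
    define h where "h = X k - xbar"
    define R where "R = F (X k) - F xbar - F' (X k) h"
    have "lbar \<bullet> (F (X k) - F xbar) \<le> 0"
      using lbar(1) tangent_cone_convex[OF polyhedron_imp_convex[OF A(1)] A(2) X(2)]
      unfolding frechet_normal_cone_def by blast
    then have "0 \<le> (l k - lbar) \<bullet> (F (X k) - F xbar)"
      by (simp add: inner_diff_left l(2))
    moreover have "(t k)\<^sup>2 * Q k = (f' (X k) h - f' xbar h) + lbar \<bullet> (F' (X k) h - F' xbar h)"
      using t[of k] by (simp add: Q_def u_def h_def[symmetric] blinfun.bilinear_simps inner_diff_right
          power2_eq_square field_simps)
    \<comment> \<open>Both stationarity equations reduce the left side to the product of
      \<open>lbar - l k\<close> with \<open>F' (X k) h\<close>, which is split by the definition of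
      \<open>R\<close>. The increment term has a favourable sign, and the quadratic remainder is
      multiplied by a factor tending to 0.\<close>
    moreover have "\<dots> = (l k - lbar) \<bullet> R - (l k - lbar) \<bullet> (F (X k) - F xbar)"
      using l(3)[of k h] lbar(2)[of h]
      by (simp add: R_def inner_diff_left inner_diff_right)
    moreover have "(l k - lbar) \<bullet> R \<le> norm (l k - lbar) * (K * (t k)\<^sup>2)"
      using X(3)[of k] unfolding R_def h_def
      by (intro order.trans[OF norm_cauchy_schwarz] mult_left_mono) auto
    ultimately have "(t k)\<^sup>2 * Q k \<le> (t k)\<^sup>2 * (norm (l k - lbar) * K)"
      by (simp add: algebra_simps)
    then show ?thesis
      using t[of k] by simp
  qed
  moreover have "(\<lambda>k. norm (l k - lbar) * K) \<longlonglongrightarrow> norm (lbar - lbar) * K"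
    by (intro tendsto_intros \<open>l \<longlonglongrightarrow> lbar\<close>)
  ultimately have "f'' d d + lbar \<bullet> F'' d d \<le> norm (lbar - lbar) * K"
    using LIMSEQ_le[OF limQ] by blast
  with pos show False
    by simp
qed

section \<open>Derivatives of the Lagrangian\<close>

text \<open>The sum is the Riesz representer of \<open>v\<close> in the standard basis.\<close>

lemma gderiv_blinfun:
  fixes v :: "(real^'n) \<Rightarrow>\<^sub>L real"
  assumes "(g has_derivative blinfun_apply v) (at x)"
  shows "GDERIV g x :> (\<Sum>b\<in>Basis. v b *\<^sub>R b)"
proof -
  have "h \<bullet> (\<Sum>b\<in>Basis. v b *\<^sub>R b) = v h" for h
  proof -
    have "v h = v (\<Sum>b\<in>Basis. (h \<bullet> b) *\<^sub>R b)"
      by (simp add: euclidean_representation)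
    then show ?thesis
      by (simp add: blinfun.sum_right blinfun.scaleR_right inner_sum_right mult.commute)
  qed
  with assms show ?thesis
    by (simp add: gderiv_def)
qed

lemma gradient_inner:
  fixes v :: "(real^'n) \<Rightarrow>\<^sub>L real"
  assumes "(g has_derivative blinfun_apply v) (at x)"
  shows "gradient g x \<bullet> h = v h"
proof -
  have "GDERIV g x :> gradient g x"
    using gderiv_blinfun[OF assms] gradient_eqI by metis
  then show ?thesis
    using has_derivative_unique[OF assms] unfolding gderiv_def
    by (metis inner_commute)
qed

lemma gradient_eq_zero_iff:
  fixes v :: "(real^'n) \<Rightarrow>\<^sub>L real"
  assumes "(g has_derivative blinfun_apply v) (at x)"
  shows "gradient g x = 0 \<longleftrightarrow> (\<forall>h. v h = 0)"
  using gradient_inner[OF assms] by (metis inner_eq_zero_iff inner_zero_left)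

text \<open>The gradient is the image of \<open>g'\<close> under the linear Riesz map, so its
  derivative is the same map applied to \<open>g''\<close>.\<close>

lemma hessian_quadratic_form:
  fixes g' :: "real^'n \<Rightarrow> (real^'n) \<Rightarrow>\<^sub>L real"
  assumes g: "\<And>x. (g has_derivative blinfun_apply (g' x)) (at x)"
    and g': "(g' has_derivative g'') (at x)"
  shows "d \<bullet> (hessian g x *v d) = g'' d d"
proof -
  let ?G = "\<lambda>h. \<Sum>b\<in>Basis. g'' h b *\<^sub>R b"
  have eq: "gradient g = (\<lambda>x. \<Sum>b\<in>Basis. g' x b *\<^sub>R b)"
    using gradient_eqI[OF gderiv_blinfun[OF g]] by blast
  have der: "(gradient g has_derivative ?G) (at x)"
    unfolding eq by (auto intro!: derivative_eq_intros g')
  then have "(gradient g has_derivative (\<lambda>h. hessian g x *v h)) (at x)"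
    unfolding hessian_def using jacobian_works differentiableI by blast
  from has_derivative_unique[OF this der] have "hessian g x *v d = ?G d"
    by (rule fun_cong)
  also have "d \<bullet> \<dots> = g'' d (\<Sum>b\<in>Basis. (d \<bullet> b) *\<^sub>R b)"
    by (simp add: blinfun.sum_right blinfun.scaleR_right inner_sum_right mult.commute)
  finally show ?thesis
    by (simp add: euclidean_representation)
qed

text \<open>Stated as a bounded linear map rather than a function, so that it can be differentiated
  once more with respect to the base point.\<close>

definition lagrangian_deriv ::
    "('a::euclidean_space \<Rightarrow>\<^sub>L real) \<Rightarrow> ('a \<Rightarrow>\<^sub>L 'b::euclidean_space) \<Rightarrow> 'b \<Rightarrow> 'a \<Rightarrow>\<^sub>L real" where
  "lagrangian_deriv u V l = u + (blinfun_inner_left l o\<^sub>L V)"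

lemma lagrangian_deriv_apply [simp]: "lagrangian_deriv u V l h = u h + l \<bullet> V h"
  by (simp add: lagrangian_deriv_def blinfun.add_left inner_commute)

lemma has_derivative_lagrangian:
  assumes "(f has_derivative blinfun_apply u) (at x)" "(F has_derivative blinfun_apply V) (at x)"
  shows "((\<lambda>z. lagrangian f F z l) has_derivative blinfun_apply (lagrangian_deriv u V l)) (at x)"
  unfolding lagrangian_def
  by (auto intro!: derivative_eq_intros assms simp: inner_commute)

lemma has_derivative_lagrangian_deriv:
  assumes "(f' has_derivative f'') (at x)" "(F' has_derivative F'') (at x)"
  shows "((\<lambda>z. lagrangian_deriv (f' z) (F' z) l) has_derivative
    (\<lambda>h. lagrangian_deriv (f'' h) (F'' h) l)) (at x)"
  unfolding lagrangian_deriv_def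
  by (auto intro!: derivative_eq_intros assms)

section \<open>From one polyhedral piece to the union\<close>

text \<open>An element of one span lies in the Minkowski sum, with zeros as the other summands.
  Testing with the transposed Jacobian applied to \<open>l\<close> shows that this vector
  vanishes.\<close>

lemma MPDC_LICQ_inj:
  assumes "MPDC_LICQ F D r x" "i \<in> active_indices F D r x"
    and l: "l \<in> span (frechet_normal_cone (D i) (F x))" "\<And>h. l \<bullet> (jacobian F (at x) *v h) = 0"
  shows "l = 0"
proof -
  let ?I = "active_indices F D r x"
  have fin: "finite ?I"
    by (simp add: active_indices_def)
  have "l = (\<Sum>j\<in>?I. if j = i then l else 0)"
    using fin assms(2) by simp
  then have "l \<in> (\<Sum>j\<in>?I. span (frechet_normal_cone (D j) (F x)))"
    unfolding set_sum_alt[OF fin] using l(1)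
    by (intro CollectI exI[of _ "\<lambda>j. if j = i then l else 0"]) (auto simp: span_zero)
  moreover have "transpose (jacobian F (at x)) *v l = 0"
    using l(2)[of "transpose (jacobian F (at x)) *v l"]
    by (metis dot_lmul_matrix inner_eq_zero_iff transpose_matrix_vector)
  ultimately show ?thesis
    using assms(1) unfolding MPDC_LICQ_def by blast
qed

theorem theorem4p5:
  fixes f :: "real^'n \<Rightarrow> real"
    and F :: "real^'n \<Rightarrow> real^'m"
    and D :: "nat \<Rightarrow> (real^'m) set"
    and r :: nat
    and xbar :: "real^'n"
  assumes "twice_cont_diff f"
    and "twice_cont_diff F"
    and "\<And>i. i \<in> {1..r} \<Longrightarrow> polyhedron (D i)"
    and "xbar \<in> feasible_set F D r"
    and "S_stationary f F D r xbar"
    and "MPDC_LICQ F D r xbar"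
    and "MPDC_SOSC f F D r xbar"
  shows "\<exists>lbar. S_multipliers f F D r xbar = {lbar} \<and>
    (\<exists>\<epsilon>>0. \<forall>x\<in>feasible_set F D r. norm (x - xbar) \<le> \<epsilon> \<longrightarrow>
      (\<forall>l. l \<in> S_multipliers f F D r x \<longrightarrow> x = xbar \<and> l = lbar))"
proof -
  obtain f' and f'' :: "real^'n \<Rightarrow> (real^'n) \<Rightarrow>\<^sub>L ((real^'n) \<Rightarrow>\<^sub>L real)"
    where f: "\<And>x. (f has_derivative blinfun_apply (f' x)) (at x)"
      "\<And>x. (f' has_derivative blinfun_apply (f'' x)) (at x)"
    using assms(1) unfolding twice_cont_diff_def by blast
  obtain F' and F'' :: "real^'n \<Rightarrow> (real^'n) \<Rightarrow>\<^sub>L ((real^'n) \<Rightarrow>\<^sub>L (real^'m))"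
    where F: "\<And>x. (F has_derivative blinfun_apply (F' x)) (at x)"
      "\<And>x. (F' has_derivative blinfun_apply (F'' x)) (at x)"
    using assms(2) unfolding twice_cont_diff_def by blast
  let ?S = "S_multipliers f F D r" and ?I = "active_indices F D r"
  have S: "l \<in> ?S x \<longleftrightarrow> (\<forall>i\<in>?I x. l \<in> frechet_normal_cone (D i) (F x)) \<and>
      (\<forall>h. f' x h + l \<bullet> F' x h = 0)" for l x
    by (auto simp: S_multipliers_def gradient_eq_zero_iff[OF has_derivative_lagrangian[OF f(1) F(1)]])
  have jac: "jacobian F (at x) *v h = F' x h" for x h
    using has_derivative_unique[OF jacobian_works[THEN iffD1, OF differentiableI[OF F(1)]] F(1)]
    by (rule fun_cong)
  have inj: "l = 0" if "i \<in> ?I xbar" "l \<in> span (frechet_normal_cone (D i) (F xbar))"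
    "\<And>h. l \<bullet> F' xbar h = 0" for i l
    using MPDC_LICQ_inj[OF assms(6)] that by (simp add: jac)
  obtain lbar where lbar: "lbar \<in> ?S xbar"
    using assms(5) unfolding S_stationary_def by blast
  obtain i0 where i0: "i0 \<in> ?I xbar"
    using assms(4) unfolding feasible_set_def constraint_set_def active_indices_def by blast
  \<comment> \<open>The difference of two multipliers lies in the span of a single active normal
    cone and annihilates the range of \<open>F' xbar\<close>.\<close>
  have uniq: "?S xbar = {lbar}"
  proof (intro equalityI subsetI)
    fix l assume l: "l \<in> ?S xbar"
    have "l - lbar = 0"
    proof (rule inj[OF i0])
      show "l - lbar \<in> span (frechet_normal_cone (D i0) (F xbar))"
        using l lbar i0 unfolding S by (intro span_diff span_base) auto
      show "(l - lbar) \<bullet> F' xbar h = 0" for h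
      proof -
        have "f' xbar h + l \<bullet> F' xbar h = 0" "f' xbar h + lbar \<bullet> F' xbar h = 0"
          using l lbar unfolding S by blast+
        then show ?thesis
          by (simp add: inner_diff_left)
      qed
    qed
    then show "l \<in> {lbar}"
      by simp
  qed (use lbar in simp)
  \<comment> \<open>SOSC lets the multiplier depend on \<open>d\<close>, but uniqueness forces it to
    be \<open>lbar\<close>.\<close>
  have sosc: "f'' xbar d d + lbar \<bullet> F'' xbar d d > 0"
    if "d \<noteq> 0" "F' xbar d \<in> tangent_cone (constraint_set D r) (F xbar)" "f' xbar d \<le> 0" for d
  proof -
    have "d \<in> critical_cone f F D r xbar - {0}"
      using that by (simp add: critical_cone_def linearization_cone_def jac gradient_inner[OF f(1)])
    with assms(7) uniq have "d \<bullet> (hessian (\<lambda>z. lagrangian f F z lbar) xbar *v d) > 0"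
      unfolding MPDC_SOSC_def by auto
    then show ?thesis
      by (simp add: hessian_quadratic_form[OF has_derivative_lagrangian[OF f(1) F(1)]
            has_derivative_lagrangian_deriv[OF f(2) F(2)]])
  qed
  \<comment> \<open>There are finitely many pieces, so each may have its own neighbourhood. Active
    pieces fall under the local result, where a multiplier at \<open>x\<close> is in particular
    normal to \<open>D i\<close>; inactive ones are closed and hence avoided near
    \<open>xbar\<close>.\<close>
  have "\<forall>\<^sub>F x in at xbar. F x \<in> D i \<longrightarrow> ?S x = {}" if i: "i \<in> {1..r}" for i
  proof (cases "F xbar \<in> D i")
    case True
    then have act: "i \<in> ?I xbar"
      using i by (simp add: active_indices_def)
    have sub: "D i \<subseteq> constraint_set D r"
      using i by (auto simp: constraint_set_def)
    have "\<forall>\<^sub>F x in at xbar. F x \<in> D i \<longrightarrow>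
        \<not> (\<exists>l\<in>frechet_normal_cone (D i) (F x). \<forall>h. f' x h + l \<bullet> F' x h = 0)"
    proof (rule isolated_stationary_point_polyhedron[OF F(1) f(2) F(2) assms(3)[OF i] True])
      show "lbar \<in> frechet_normal_cone (D i) (F xbar)" "f' xbar h + lbar \<bullet> F' xbar h = 0" for h
        using lbar act by (auto simp: S)
    qed (use inj[OF act] sosc tangent_cone_mono[OF sub] in blast)+
    then show ?thesis
    proof eventually_elim
      case (elim x)
      have "i \<in> ?I x" if "F x \<in> D i"
        using i that by (simp add: active_indices_def)
      with elim S show ?case
        by blast
    qed
  next
    case False
    have "(F \<longlongrightarrow> F xbar) (at xbar)"
      using has_derivative_continuous[OF F(1)] by (simp add: isCont_def)
    then have "\<forall>\<^sub>F x in at xbar. F x \<in> - D i"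
      using False polyhedron_imp_closed[OF assms(3)[OF i]]
      by (intro topological_tendstoD) auto
    then show ?thesis
      by eventually_elim simp
  qed
  then have "\<forall>\<^sub>F x in at xbar. \<forall>i\<in>{1..r}. F x \<in> D i \<longrightarrow> ?S x = {}"
    by (intro eventually_ball_finite) auto
  then obtain \<epsilon> where \<epsilon>: "\<epsilon> > 0"
    "\<And>x. x \<noteq> xbar \<Longrightarrow> norm (x - xbar) < \<epsilon> \<Longrightarrow> \<forall>i\<in>{1..r}. F x \<in> D i \<longrightarrow> ?S x = {}"
    unfolding eventually_at dist_norm by blast
  \<comment> \<open>Halving the radius passes from the open ball to the closed one.\<close>
  have "x = xbar \<and> l = lbar" if "x \<in> feasible_set F D r" "norm (x - xbar) \<le> \<epsilon> / 2" "l \<in> ?S x" for x l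
  proof -
    have "x = xbar"
      using \<epsilon> that unfolding feasible_set_def constraint_set_def by fastforce
    with that(3) uniq show ?thesis
      by simp
  qed
  with uniq \<epsilon>(1) show ?thesis
    by (intro exI[of _ lbar] conjI exI[of _ "\<epsilon> / 2"]) auto
qed

end
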